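(* Let $(I,\le)$ be a directed set and let $\mathcal G=(G_i,\|\cdot\|_i,f_{i,j})_{i\le j\in I}$ be a direct system of metric groups with $\|\cdot\|_i\le1$ for all $i\in I$. Suppose that for any reals $0<r<t$ there is $N\in\mathbb N$ such that for any $i,j\in I$, $g\in G_i$, $h\in G_j$ with $\|g\|_i>r$ and $\|h\|_j<t$ there is $k\in I$, $k>i,j$, such that $$f_{j,k}(h)\in C_N(f_{i,k}(g),G_k).$$ Then the direct limit $G=\varinjlim\mathcal G$ is metrically uniformly simple, and hence its metric ultrapower $G^*_{\mathrm{met,fin}}$ (with respect to a non-principal ultrafilter on $\mathbb N$) is a metrically uniformly simple group.
   Context: A metric group is a group with a bi-invariant norm: $\|e\|=0$, $\|gh\|\le\|g\|+\|h\|$, $\|g^{-1}\|=\|g\|=\|hgh^{-1}\|$, and $\|g\|=0$ iff $g=e$. In a direct system of metric groups, each $f_{i,j}\colon G_i\to G_j$ ($i\le j$) is an isometric homomorphism ($\|f_{i,j}(g)\|_j=\|g\|_i$), $f_{i,i}=\mathrm{id}$ and $f_{i,k}=f_{j,k}\circ f_{i,j}$ for $i\le j\le k$. The direct limit is the usual direct limit of groups (the disjoint union of the $G_i$ modulo $g\sim h$ iff $f_{i,k}(g)=f_{j,k}(h)$ for some $k\ge i,j$, where $g\in G_i$, $h\in G_j$) with norm $\|[g]_\sim\|=\|g\|_i$ for $g\in G_i$. $C_N(g,G)$ is the set of all products of at most $N$ conjugates (in $G$) of $g$ and $g^{-1}$. $(G,\|\cdot\|)$ is metrically uniformly simple if for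 all $t>r>0$ there is $N\in\mathbb N$ such that $C_N(g,G)\supseteq\{h\in G : \|h\|<t\}$ for all $g\in G$ with $\|g\|\in(r,t]$. The metric ultrapower is $G^*_{\mathrm{met}}=G^{\mathbb N}/\mathcal E$, $\mathcal E=\{(g_n) : \lim_{n\to\mathcal U}\|g_n\|=0\}$, with norm $\lim_{n\to\mathcal U}\|g_n\|$; $G^*_{\mathrm{met,fin}}$ is its subgroup of elements of finite norm (here, all of it). *)

theory Defs
  imports "HOL-Algebra.Product_Groups" "HOL-Library.Extended_Real"
begin

locale metric_group = group G for G :: "('a, 'b) monoid_scheme" (structure) +
  fixes nrm :: "'a \<Rightarrow> real"
  assumes norm_mult: "\<lbrakk>g \<in> carrier G; h \<in> carrier G\<rbrakk> \<Longrightarrow> nrm (g \<otimes> h) \<le> nrm g + nrm h"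
    and norm_inv: "g \<in> carrier G \<Longrightarrow> nrm (inv g) = nrm g"
    and norm_conj: "\<lbrakk>g \<in> carrier G; h \<in> carrier G\<rbrakk> \<Longrightarrow> nrm (h \<otimes> g \<otimes> inv h) = nrm g"
    and norm_eq_0_iff: "g \<in> carrier G \<Longrightarrow> nrm g = 0 \<longleftrightarrow> g = \<one>"

text \<open>The empty product is allowed.\<close>

definition conj_products :: "nat \<Rightarrow> 'a \<Rightarrow> ('a, 'b) monoid_scheme \<Rightarrow> 'a set" where
  "conj_products N g G =
     {foldr (\<otimes>\<^bsub>G\<^esub>) xs \<one>\<^bsub>G\<^esub> | xs. length xs \<le> N \<and>
        set xs \<subseteq> {x \<otimes>\<^bsub>G\<^esub> y \<otimes>\<^bsub>G\<^esub> inv\<^bsub>G\<^esub> x | x y. x \<in> carrier G \<and> y \<in> {g, inv\<^bsub>G\<^esub> g}}}"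

definition metrically_uniformly_simple :: "('a, 'b) monoid_scheme \<Rightarrow> ('a \<Rightarrow> real) \<Rightarrow> bool" where
  "metrically_uniformly_simple G nrm \<longleftrightarrow> metric_group G nrm \<and>
     (\<forall>r t. 0 < r \<and> r < t \<longrightarrow>
        (\<exists>N. \<forall>g\<in>carrier G. nrm g \<in> {r<..t} \<longrightarrow>
           {h \<in> carrier G. nrm h < t} \<subseteq> conj_products N g G))"


section \<open>Direct systems of metric groups and their direct limits\<close>

text \<open>All groups of the system live on one type, with arbitrary carriers that may overlap;
  the disjoint union is therefore taken as a \<open>Sigma\<close> set.\<close>

locale directed_set =
  fixes I :: "'i set" and leI :: "'i \<Rightarrow> 'i \<Rightarrow> bool"
  assumes nonempty: "I \<noteq> {}"
    and le_refl: "i \<in> I \<Longrightarrow> leI i i"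
    and le_trans: "\<lbrakk>i \<in> I; j \<in> I; k \<in> I; leI i j; leI j k\<rbrakk> \<Longrightarrow> leI i k"
    and upper_bound: "\<lbrakk>i \<in> I; j \<in> I\<rbrakk> \<Longrightarrow> \<exists>k\<in>I. leI i k \<and> leI j k"

locale direct_system = directed_set I leI
  for I :: "'i set" and leI :: "'i \<Rightarrow> 'i \<Rightarrow> bool" +
  fixes G :: "'i \<Rightarrow> ('a, 'b) monoid_scheme"
    and nrm :: "'i \<Rightarrow> 'a \<Rightarrow> real"
    and f :: "'i \<Rightarrow> 'i \<Rightarrow> 'a \<Rightarrow> 'a"
  assumes metric_groups: "i \<in> I \<Longrightarrow> metric_group (G i) (nrm i)"
    and f_hom: "\<lbrakk>i \<in> I; j \<in> I; leI i j\<rbrakk> \<Longrightarrow> f i j \<in> hom (G i) (G j)"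
    and f_isometric: "\<lbrakk>i \<in> I; j \<in> I; leI i j; g \<in> carrier (G i)\<rbrakk> \<Longrightarrow> nrm j (f i j g) = nrm i g"
    and f_id: "\<lbrakk>i \<in> I; g \<in> carrier (G i)\<rbrakk> \<Longrightarrow> f i i g = g"
    and f_comp: "\<lbrakk>i \<in> I; j \<in> I; k \<in> I; leI i j; leI j k; g \<in> carrier (G i)\<rbrakk> \<Longrightarrow>
           f i k g = f j k (f i j g)"

definition dirlim_rel ::
  "'i set \<Rightarrow> ('i \<Rightarrow> 'i \<Rightarrow> bool) \<Rightarrow> ('i \<Rightarrow> ('a, 'b) monoid_scheme) \<Rightarrow> ('i \<Rightarrow> 'i \<Rightarrow> 'a \<Rightarrow> 'a)
     \<Rightarrow> (('i \<times> 'a) \<times> ('i \<times> 'a)) set" where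
  "dirlim_rel I leI G f =
     {((i, g), (j, h)) | i g j h. i \<in> I \<and> j \<in> I \<and> g \<in> carrier (G i) \<and> h \<in> carrier (G j) \<and>
        (\<exists>k\<in>I. leI i k \<and> leI j k \<and> f i k g = f j k h)}"

text \<open>Two classes are multiplied by taking representatives in a common \<open>G i\<close>. The unions below
  are over equal classes, i.e. they just pick out the class of any such product, respectively
  of any unit.\<close>

definition dirlim ::
  "'i set \<Rightarrow> ('i \<Rightarrow> 'i \<Rightarrow> bool) \<Rightarrow> ('i \<Rightarrow> ('a, 'b) monoid_scheme) \<Rightarrow> ('i \<Rightarrow> 'i \<Rightarrow> 'a \<Rightarrow> 'a)
     \<Rightarrow> ('i \<times> 'a) set monoid" where
  "dirlim I leI G f =
     \<lparr>carrier = (SIGMA i:I. carrier (G i)) // dirlim_rel I leI G f,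
      monoid.mult = (\<lambda>A B. \<Union>{dirlim_rel I leI G f `` {(i, g \<otimes>\<^bsub>G i\<^esub> h)} | i g h. (i, g) \<in> A \<and> (i, h) \<in> B}),
      one = (\<Union>i\<in>I. dirlim_rel I leI G f `` {(i, \<one>\<^bsub>G i\<^esub>)})\<rparr>"

definition dirlim_norm :: "('i \<Rightarrow> 'a \<Rightarrow> real) \<Rightarrow> ('i \<times> 'a) set \<Rightarrow> real" where
  "dirlim_norm nrm A = (THE r. \<exists>(i, g)\<in>A. r = nrm i g)"


section \<open>Metric ultrapowers\<close>

definition nonprincipal_ultrafilter :: "'n filter \<Rightarrow> bool" where
  "nonprincipal_ultrafilter \<U> \<longleftrightarrow> \<U> \<noteq> bot \<and>
     (\<forall>P. eventually P \<U> \<or> eventually (\<lambda>n. \<not> P n) \<U>) \<and> (\<forall>n. \<U> \<noteq> principal {n})"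

definition ultra_null ::
  "('a, 'b) monoid_scheme \<Rightarrow> ('a \<Rightarrow> real) \<Rightarrow> nat filter \<Rightarrow> (nat \<Rightarrow> 'a) set" where
  "ultra_null G nrm \<U> =
     {x \<in> carrier (product_group UNIV (\<lambda>_. G)). ((\<lambda>n. nrm (x n)) \<longlongrightarrow> 0) \<U>}"

definition met_ultrapower ::
  "('a, 'b) monoid_scheme \<Rightarrow> ('a \<Rightarrow> real) \<Rightarrow> nat filter \<Rightarrow> (nat \<Rightarrow> 'a) set monoid" where
  "met_ultrapower G nrm \<U> = product_group UNIV (\<lambda>_. G) Mod ultra_null G nrm \<U>"

text \<open>For an unbounded norm the limit along \<open>\<U>\<close> may be infinite, so it is taken in \<^typ>\<open>ereal\<close>.
  It does not depend on the representative of the coset.\<close>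

definition ultra_norm :: "('a \<Rightarrow> real) \<Rightarrow> nat filter \<Rightarrow> (nat \<Rightarrow> 'a) set \<Rightarrow> ereal" where
  "ultra_norm nrm \<U> A = (THE l. \<exists>x\<in>A. l = Lim \<U> (\<lambda>n. ereal (nrm (x n))))"

definition met_ultrapower_fin ::
  "('a, 'b) monoid_scheme \<Rightarrow> ('a \<Rightarrow> real) \<Rightarrow> nat filter \<Rightarrow> (nat \<Rightarrow> 'a) set monoid" where
  "met_ultrapower_fin G nrm \<U> =
     (met_ultrapower G nrm \<U>)
       \<lparr>carrier := {A \<in> carrier (met_ultrapower G nrm \<U>). ultra_norm nrm \<U> A < \<infinity>}\<rparr>"

definition ultra_fin_norm :: "('a \<Rightarrow> real) \<Rightarrow> nat filter \<Rightarrow> (nat \<Rightarrow> 'a) set \<Rightarrow> real" where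
  "ultra_fin_norm nrm \<U> A = real_of_ereal (ultra_norm nrm \<U> A)"

end

theory Submission
  imports Defs "HOL-Analysis.Elementary_Normed_Spaces"
begin

text \<open>The canonical maps \<open>G i \<rightarrow> lim\<close> are isometric homomorphisms, and homomorphisms preserve
  \<open>C\<^sub>N\<close>; so the hypothesis, applied to representatives, gives metric uniform simplicity of the
  limit. For the ultrapower, representatives of \<open>X\<close> with \<open>r < \<parallel>X\<parallel> \<le> t\<close> and of \<open>Y\<close> with
  \<open>\<parallel>Y\<parallel> < t\<close> satisfy \<open>r < \<parallel>x n\<parallel> < t + 1\<close> and \<open>\<parallel>y n\<parallel> < t + 1\<close> for \<open>\<U>\<close>-almost all \<open>n\<close>. Hence
  \<open>y n \<in> C\<^sub>N(x n)\<close> with a single \<open>N\<close> for \<open>(r, t + 1)\<close>, and since \<open>N\<close> does not depend on \<open>n\<close> this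
  passes to the ultrapower. Boundedness of the norm makes all conjugators available there.\<close>

section \<open>Products of conjugates\<close>

lemma one_in_conj_products: "\<one>\<^bsub>G\<^esub> \<in> conj_products N g G"
  unfolding conj_products_def by (auto intro!: exI[of _ "[]"])

lemma conj_products_0: "conj_products 0 g G = {\<one>\<^bsub>G\<^esub>}"
  unfolding conj_products_def by auto

text \<open>Together with \<open>conj_products_SucE\<close> this turns the list definition into a
  recursion on the length bound, so that later facts about these sets are inductions on
  \<open>N\<close>.\<close>

lemma conj_products_SucI:
  assumes "x \<in> carrier G" "y \<in> {g, inv\<^bsub>G\<^esub> g}" "p \<in> conj_products N g G"
  shows "(x \<otimes>\<^bsub>G\<^esub> y \<otimes>\<^bsub>G\<^esub> inv\<^bsub>G\<^esub> x) \<otimes>\<^bsub>G\<^esub> p \<in> conj_products (Suc N) g G"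
proof -
  obtain xs where xs: "p = foldr (\<otimes>\<^bsub>G\<^esub>) xs \<one>\<^bsub>G\<^esub>" "length xs \<le> N"
      "set xs \<subseteq> {x \<otimes>\<^bsub>G\<^esub> y \<otimes>\<^bsub>G\<^esub> inv\<^bsub>G\<^esub> x | x y. x \<in> carrier G \<and> y \<in> {g, inv\<^bsub>G\<^esub> g}}"
    using assms(3) unfolding conj_products_def by blast
  show ?thesis
    unfolding conj_products_def
    by (rule CollectI, rule exI[of _ "(x \<otimes>\<^bsub>G\<^esub> y \<otimes>\<^bsub>G\<^esub> inv\<^bsub>G\<^esub> x) # xs"]) (use xs assms(1,2) in auto)
qed

text \<open>A list of length at most \<open>Suc N\<close> may be empty, hence the separate unit
  case. Otherwise its head is the conjugate and its tail has length at most
  \<open>N\<close>.\<close>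

lemma conj_products_SucE:
  assumes "h \<in> conj_products (Suc N) g G"
  obtains "h = \<one>\<^bsub>G\<^esub>"
  | x y p where "x \<in> carrier G" "y \<in> {g, inv\<^bsub>G\<^esub> g}" "p \<in> conj_products N g G"
      "h = (x \<otimes>\<^bsub>G\<^esub> y \<otimes>\<^bsub>G\<^esub> inv\<^bsub>G\<^esub> x) \<otimes>\<^bsub>G\<^esub> p"
proof -
  obtain xs where xs: "h = foldr (\<otimes>\<^bsub>G\<^esub>) xs \<one>\<^bsub>G\<^esub>" "length xs \<le> Suc N"
      "set xs \<subseteq> {x \<otimes>\<^bsub>G\<^esub> y \<otimes>\<^bsub>G\<^esub> inv\<^bsub>G\<^esub> x | x y. x \<in> carrier G \<and> y \<in> {g, inv\<^bsub>G\<^esub> g}}"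
    using assms unfolding conj_products_def by blast
  show thesis
  proof (cases xs)
    case Nil
    then show ?thesis using xs that(1) by simp
  next
    case (Cons c cs)
    then obtain x y where xy: "x \<in> carrier G" "y \<in> {g, inv\<^bsub>G\<^esub> g}" "c = x \<otimes>\<^bsub>G\<^esub> y \<otimes>\<^bsub>G\<^esub> inv\<^bsub>G\<^esub> x"
      using xs(3) by auto
    have "foldr (\<otimes>\<^bsub>G\<^esub>) cs \<one>\<^bsub>G\<^esub> \<in> conj_products N g G"
      unfolding conj_products_def
      by (rule CollectI, rule exI[of _ cs]) (use xs Cons in auto)
    with xy Cons xs(1) that(2) show ?thesis by simp
  qed
qed

lemma (in group) conj_products_closed:
  assumes "g \<in> carrier G"
  shows "conj_products N g G \<subseteq> carrier G"
proof (induction N)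
  case 0
  show ?case by (simp add: conj_products_0)
next
  case (Suc N)
  show ?case
  proof
    fix h assume "h \<in> conj_products (Suc N) g G"
    then show "h \<in> carrier G"
      by (cases rule: conj_products_SucE) (use Suc assms in auto)
  qed
qed

text \<open>Homomorphisms commute with conjugation and inversion, so each factor goes to a factor
  and their number does not grow. This is how membership at one stage is carried into the
  limit.\<close>

lemma (in group_hom) conj_products_hom:
  assumes g: "g \<in> carrier G" and "p \<in> conj_products N g G"
  shows "h p \<in> conj_products N (h g) H"
  using assms(2)
proof (induction N arbitrary: p)
  case 0
  then show ?case by (simp add: conj_products_0)
next
  case (Suc N)
  from Suc.prems show ?case
  proof (cases rule: conj_products_SucE)
    case 1
    then show ?thesis by (simp add: one_in_conj_products)
  next
    case (2 x y q)
    have q: "q \<in> carrier G" using 2 G.conj_products_closed[OF g] by blast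
    have y: "y \<in> carrier G" using 2 g by auto
    have "h p = (h x \<otimes>\<^bsub>H\<^esub> h y \<otimes>\<^bsub>H\<^esub> inv\<^bsub>H\<^esub> h x) \<otimes>\<^bsub>H\<^esub> h q"
      using 2 q y by simp
    moreover have "h y \<in> {h g, inv\<^bsub>H\<^esub> h g}" using 2(2) g by auto
    ultimately show ?thesis
      using conj_products_SucI[OF hom_closed[OF 2(1)] _ Suc.IH[OF 2(3)]] by simp
  qed
qed

section \<open>Elementary estimates for bi-invariant norms\<close>

context metric_group
begin

lemma norm_one: "nrm \<one> = 0"
  using norm_eq_0_iff by simp

text \<open>The unit is the product of \<open>g\<close> and its inverse, so the triangle inequality
  gives 0 \<le> 2 \<open>nrm g\<close>.\<close>

lemma norm_nonneg:
  assumes "g \<in> carrier G"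
  shows "0 \<le> nrm g"
  using norm_mult[of g "inv g"] norm_inv[of g] norm_one assms by simp

text \<open>The lower estimate comes from cancelling \<open>g\<close> with its inverse. The bound
  will show that a null factor does not affect limits of norms.\<close>

lemma norm_mult_diff:
  assumes "g \<in> carrier G" "h \<in> carrier G"
  shows "\<bar>nrm (g \<otimes> h) - nrm h\<bar> \<le> nrm g"
proof -
  have "nrm h = nrm (inv g \<otimes> (g \<otimes> h))" using assms by (simp add: m_assoc[symmetric])
  also have "\<dots> \<le> nrm (inv g) + nrm (g \<otimes> h)" using assms by (intro norm_mult) auto
  finally show ?thesis using norm_mult[OF assms] norm_inv[OF assms(1)] by linarith
qed

end

section \<open>Direct limits\<close>

context direct_system
begin

abbreviation lim :: "('i \<times> 'a) set monoid" where
  "lim \<equiv> dirlim I leI G f"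

text \<open>The canonical map of stage \<open>i\<close> into the limit. Outside \<open>I\<close> or
  the carrier its value is empty, so membership in a class already yields all carrier
  conditions.\<close>

definition inj_lim :: "'i \<Rightarrow> 'a \<Rightarrow> ('i \<times> 'a) set" where
  "inj_lim i g = dirlim_rel I leI G f `` {(i, g)}"

section \<open>Transition maps and the equivalence relation\<close>

lemma group_G: "i \<in> I \<Longrightarrow> group (G i)"
  using metric_groups by (simp add: metric_group_def)

lemma f_closed: "\<lbrakk>i \<in> I; j \<in> I; leI i j; g \<in> carrier (G i)\<rbrakk> \<Longrightarrow> f i j g \<in> carrier (G j)"
  using f_hom by (auto simp: hom_def)

lemma f_mult:
  "\<lbrakk>i \<in> I; j \<in> I; leI i j; g \<in> carrier (G i); h \<in> carrier (G i)\<rbrakk> \<Longrightarrow>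
     f i j (g \<otimes>\<^bsub>G i\<^esub> h) = f i j g \<otimes>\<^bsub>G j\<^esub> f i j h"
  using f_hom by (auto simp: hom_def)

lemma f_one: "\<lbrakk>i \<in> I; j \<in> I; leI i j\<rbrakk> \<Longrightarrow> f i j \<one>\<^bsub>G i\<^esub> = \<one>\<^bsub>G j\<^esub>"
  by (intro hom_one f_hom group_G)

lemma dirlim_rel_iff:
  "((i, g), (j, h)) \<in> dirlim_rel I leI G f \<longleftrightarrow>
     i \<in> I \<and> j \<in> I \<and> g \<in> carrier (G i) \<and> h \<in> carrier (G j) \<and>
     (\<exists>k\<in>I. leI i k \<and> leI j k \<and> f i k g = f j k h)"
  by (auto simp: dirlim_rel_def)

text \<open>Directedness enters through transitivity: the two equalities, witnessed at stages
  \<open>k\<close> and \<open>k'\<close>, are pushed by \<open>f_comp\<close> to a common bound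
  \<open>m\<close> and chained there.\<close>

lemma equiv_dirlim_rel: "equiv (SIGMA i:I. carrier (G i)) (dirlim_rel I leI G f)"
proof (rule equivI)
  show "dirlim_rel I leI G f \<subseteq> (SIGMA i:I. carrier (G i)) \<times> (SIGMA i:I. carrier (G i))"
    by (auto simp: dirlim_rel_def)
  show "refl_on (SIGMA i:I. carrier (G i)) (dirlim_rel I leI G f)"
    using le_refl by (intro refl_onI) (clarsimp simp: dirlim_rel_iff, blast)
  show "sym (dirlim_rel I leI G f)"
    by (intro symI) (clarsimp simp: dirlim_rel_iff, metis)
  show "trans (dirlim_rel I leI G f)"
  proof (rule transI)
    fix a b c
    assume ab: "(a, b) \<in> dirlim_rel I leI G f" and bc: "(b, c) \<in> dirlim_rel I leI G f"
    obtain i g j h l e where abc: "a = (i, g)" "b = (j, h)" "c = (l, e)"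
      by (metis surj_pair)
    from ab abc obtain k where k: "k \<in> I" "leI i k" "leI j k" "f i k g = f j k h"
      and ij: "i \<in> I" "j \<in> I" "g \<in> carrier (G i)" "h \<in> carrier (G j)"
      by (auto simp: dirlim_rel_iff)
    from bc abc obtain k' where k': "k' \<in> I" "leI j k'" "leI l k'" "f j k' h = f l k' e"
      and l: "l \<in> I" "e \<in> carrier (G l)"
      by (auto simp: dirlim_rel_iff)
    obtain m where m: "m \<in> I" "leI k m" "leI k' m" using upper_bound k k' by blast
    have "f i m g = f k m (f i k g)" using f_comp k m ij by blast
    also have "\<dots> = f j m h" using f_comp[of j k m h] k m ij by simp
    also have "\<dots> = f k' m (f j k' h)" using f_comp[of j k' m h] k' m ij by simp
    also have "\<dots> = f l m e" using f_comp[of l k' m e] k' m l by simp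
    finally have "f i m g = f l m e" .
    moreover have "leI i m" using le_trans[of i k m] ij k m by blast
    moreover have "leI l m" using le_trans[of l k' m] l k' m by blast
    ultimately show "(a, c) \<in> dirlim_rel I leI G f"
      unfolding abc dirlim_rel_iff using ij l m by blast
  qed
qed

lemma mem_inj_lim_iff:
  "(j, h) \<in> inj_lim i g \<longleftrightarrow>
     i \<in> I \<and> j \<in> I \<and> g \<in> carrier (G i) \<and> h \<in> carrier (G j) \<and>
     (\<exists>k\<in>I. leI i k \<and> leI j k \<and> f i k g = f j k h)"
  by (simp add: inj_lim_def dirlim_rel_iff)

lemma inj_lim_self: "\<lbrakk>i \<in> I; g \<in> carrier (G i)\<rbrakk> \<Longrightarrow> (i, g) \<in> inj_lim i g"
  using le_refl by (auto simp: mem_inj_lim_iff)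

lemma inj_lim_eqI:
  assumes "(j, h) \<in> inj_lim i g"
  shows "inj_lim j h = inj_lim i g"
  using assms equiv_class_eq[OF equiv_dirlim_rel, of "(i, g)" "(j, h)"]
  unfolding inj_lim_def by auto

text \<open>The stage \<open>j\<close> itself witnesses the equivalence, as \<open>f j j\<close> is
  the identity. Hence representatives can be moved to any later stage.\<close>

lemma inj_lim_f:
  assumes "i \<in> I" "j \<in> I" "leI i j" "g \<in> carrier (G i)"
  shows "inj_lim j (f i j g) = inj_lim i g"
  using assms f_closed[OF assms] le_refl f_id
  by (intro inj_lim_eqI) (auto simp: mem_inj_lim_iff intro!: bexI[of _ j])

section \<open>Group structure of the limit\<close>

lemma carrier_lim: "carrier lim = {inj_lim i g | i g. i \<in> I \<and> g \<in> carrier (G i)}"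
  by (auto simp: dirlim_def quotient_def inj_lim_def)

lemma inj_lim_closed: "\<lbrakk>i \<in> I; g \<in> carrier (G i)\<rbrakk> \<Longrightarrow> inj_lim i g \<in> carrier lim"
  by (auto simp: carrier_lim)

text \<open>The units of any two stages are mapped to the same unit at a common later stage, so the
  union defining the unit of the limit is over equal classes.\<close>

lemma lim_one: "i \<in> I \<Longrightarrow> \<one>\<^bsub>lim\<^esub> = inj_lim i \<one>\<^bsub>G i\<^esub>"
proof -
  have eq: "inj_lim j \<one>\<^bsub>G j\<^esub> = inj_lim i \<one>\<^bsub>G i\<^esub>" if ij: "i \<in> I" "j \<in> I" for i j
  proof -
    obtain k where "k \<in> I" "leI i k" "leI j k" using upper_bound[OF ij] by blast
    moreover have "\<one>\<^bsub>G i\<^esub> \<in> carrier (G i)" "\<one>\<^bsub>G j\<^esub> \<in> carrier (G j)"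
      using ij group_G by (simp_all add: group.is_monoid)
    ultimately show ?thesis
      using ij f_one[of i k] f_one[of j k]
      by (intro inj_lim_eqI) (auto simp: mem_inj_lim_iff)
  qed
  assume i: "i \<in> I"
  have "\<one>\<^bsub>lim\<^esub> = (\<Union>j\<in>I. inj_lim j \<one>\<^bsub>G j\<^esub>)" by (simp add: dirlim_def inj_lim_def)
  also have "\<dots> = inj_lim i \<one>\<^bsub>G i\<^esub>" using eq[OF i] i by blast
  finally show ?thesis .
qed

text \<open>The union defining the product ranges over all pairs of representatives at a common
  stage. All of them yield the same class, so the family of classes is a singleton.\<close>

lemma lim_mult:
  assumes i: "i \<in> I" and gh: "g \<in> carrier (G i)" "h \<in> carrier (G i)"
  shows "inj_lim i g \<otimes>\<^bsub>lim\<^esub> inj_lim i h = inj_lim i (g \<otimes>\<^bsub>G i\<^esub> h)"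
proof -
  have eq: "inj_lim j (g' \<otimes>\<^bsub>G j\<^esub> h') = inj_lim i (g \<otimes>\<^bsub>G i\<^esub> h)"
    if g': "(j, g') \<in> inj_lim i g" and h': "(j, h') \<in> inj_lim i h" for j g' h'
  proof -
    obtain k where k: "k \<in> I" "leI i k" "leI j k" "f i k g = f j k g'"
      and j: "j \<in> I" "g' \<in> carrier (G j)"
      using g' by (auto simp: mem_inj_lim_iff)
    obtain l where l: "l \<in> I" "leI i l" "leI j l" "f i l h = f j l h'"
      and j': "h' \<in> carrier (G j)"
      using h' by (auto simp: mem_inj_lim_iff)
    \<comment> \<open>The stage \<open>k\<close> identifies \<open>g\<close> with \<open>g'\<close>
      and \<open>l\<close> identifies \<open>h\<close> with \<open>h'\<close>; only at a common
      bound do both equalities hold and can be multiplied.\<close>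
    obtain m where m: "m \<in> I" "leI k m" "leI l m" using upper_bound k l by blast
    have im: "leI i m" "leI j m" using le_trans i j k l m by blast+
    have "f i m g = f j m g'" using f_comp[of _ k m] i j gh k m by simp
    moreover have "f i m h = f j m h'" using f_comp[of _ l m] i j j' gh l m by simp
    ultimately have "f i m (g \<otimes>\<^bsub>G i\<^esub> h) = f j m (g' \<otimes>\<^bsub>G j\<^esub> h')"
      using f_mult i j j' gh m im by simp
    then show ?thesis
      using i j j' gh m im group.is_monoid[OF group_G]
      by (intro inj_lim_eqI) (auto simp: mem_inj_lim_iff monoid.m_closed intro!: bexI[of _ m])
  qed
  have "inj_lim i g \<otimes>\<^bsub>lim\<^esub> inj_lim i h =
      \<Union>{inj_lim j (g' \<otimes>\<^bsub>G j\<^esub> h') | j g' h'. (j, g') \<in> inj_lim i g \<and> (j, h') \<in> inj_lim i h}"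
    by (simp add: dirlim_def inj_lim_def)
  also have "{inj_lim j (g' \<otimes>\<^bsub>G j\<^esub> h') | j g' h'. (j, g') \<in> inj_lim i g \<and> (j, h') \<in> inj_lim i h} =
      {inj_lim i (g \<otimes>\<^bsub>G i\<^esub> h)}"
    using eq inj_lim_self[OF i gh(1)] inj_lim_self[OF i gh(2)] by blast
  finally show ?thesis by simp
qed

lemma lim_cases:
  assumes "A \<in> carrier lim"
  obtains i g where "i \<in> I" "g \<in> carrier (G i)" "A = inj_lim i g"
  using assms by (auto simp: carrier_lim)

text \<open>By directedness finitely many classes have representatives at one stage, which reduces
  laws of the limit to laws of a single \<open>G i\<close>.\<close>

lemma lim_cases2:
  assumes "A \<in> carrier lim" "B \<in> carrier lim"
  obtains i g h where "i \<in> I" "g \<in> carrier (G i)" "h \<in> carrier (G i)"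
    "A = inj_lim i g" "B = inj_lim i h"
proof -
  obtain i g where i: "i \<in> I" "g \<in> carrier (G i)" "A = inj_lim i g"
    using assms(1) by (rule lim_cases)
  obtain j h where j: "j \<in> I" "h \<in> carrier (G j)" "B = inj_lim j h"
    using assms(2) by (rule lim_cases)
  obtain k where k: "k \<in> I" "leI i k" "leI j k" using upper_bound i j by blast
  show thesis
    using that[OF k(1) f_closed[OF i(1) k(1,2) i(2)] f_closed[OF j(1) k(1,3) j(2)]]
      inj_lim_f i j k by simp
qed

lemma lim_cases3:
  assumes "A \<in> carrier lim" "B \<in> carrier lim" "C \<in> carrier lim"
  obtains i g h e where "i \<in> I" "g \<in> carrier (G i)" "h \<in> carrier (G i)" "e \<in> carrier (G i)"
    "A = inj_lim i g" "B = inj_lim i h" "C = inj_lim i e"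
proof -
  obtain i g h where i: "i \<in> I" "g \<in> carrier (G i)" "h \<in> carrier (G i)"
      "A = inj_lim i g" "B = inj_lim i h"
    using assms(1,2) by (rule lim_cases2)
  obtain j e where j: "j \<in> I" "e \<in> carrier (G j)" "C = inj_lim j e"
    using assms(3) by (rule lim_cases)
  obtain k where k: "k \<in> I" "leI i k" "leI j k" using upper_bound i j by blast
  show thesis
    using that[OF k(1) f_closed[OF i(1) k(1,2) i(2)] f_closed[OF i(1) k(1,2) i(3)]
        f_closed[OF j(1) k(1,3) j(2)]]
      inj_lim_f i j k by simp
qed

lemma group_lim: "group lim"
proof (rule groupI)
  fix A B assume "A \<in> carrier lim" "B \<in> carrier lim"
  then show "A \<otimes>\<^bsub>lim\<^esub> B \<in> carrier lim"
  proof (rule lim_cases2)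
    fix i g h assume *: "i \<in> I" "g \<in> carrier (G i)" "h \<in> carrier (G i)"
      "A = inj_lim i g" "B = inj_lim i h"
    interpret Gi: group "G i" using group_G *(1) .
    show ?thesis using * by (simp add: lim_mult inj_lim_closed)
  qed
next
  obtain i where i: "i \<in> I" using nonempty by blast
  interpret Gi: group "G i" using group_G i .
  show "\<one>\<^bsub>lim\<^esub> \<in> carrier lim" using i by (simp add: lim_one inj_lim_closed)
next
  fix A B C assume "A \<in> carrier lim" "B \<in> carrier lim" "C \<in> carrier lim"
  then show "A \<otimes>\<^bsub>lim\<^esub> B \<otimes>\<^bsub>lim\<^esub> C = A \<otimes>\<^bsub>lim\<^esub> (B \<otimes>\<^bsub>lim\<^esub> C)"
  proof (rule lim_cases3)
    fix i g h e assume *: "i \<in> I" "g \<in> carrier (G i)" "h \<in> carrier (G i)" "e \<in> carrier (G i)"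
      "A = inj_lim i g" "B = inj_lim i h" "C = inj_lim i e"
    interpret Gi: group "G i" using group_G *(1) .
    show ?thesis using * by (simp add: lim_mult Gi.m_assoc)
  qed
next
  fix A assume "A \<in> carrier lim"
  then obtain i g where *: "i \<in> I" "g \<in> carrier (G i)" "A = inj_lim i g" by (rule lim_cases)
  interpret Gi: group "G i" using group_G *(1) .
  show "\<one>\<^bsub>lim\<^esub> \<otimes>\<^bsub>lim\<^esub> A = A" using * by (simp add: lim_mult lim_one[OF *(1)])
  show "\<exists>B\<in>carrier lim. B \<otimes>\<^bsub>lim\<^esub> A = \<one>\<^bsub>lim\<^esub>"
    using * inj_lim_closed[of i "inv\<^bsub>G i\<^esub> g"]
    by (intro bexI[of _ "inj_lim i (inv\<^bsub>G i\<^esub> g)"]) (simp_all add: lim_mult lim_one[OF *(1)])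
qed

section \<open>Canonical homomorphisms and the norm of the limit\<close>

lemma group_hom_inj_lim:
  assumes "i \<in> I"
  shows "group_hom (G i) lim (inj_lim i)"
  using assms group_G group_lim
  by (intro group_hom.intro group_hom_axioms.intro homI) (auto simp: inj_lim_closed lim_mult)

text \<open>The definite description is well defined because the transition maps are isometric:
  equivalent representatives share an image at some stage, hence their norm.\<close>

lemma dirlim_norm_inj_lim:
  assumes "i \<in> I" "g \<in> carrier (G i)"
  shows "dirlim_norm nrm (inj_lim i g) = nrm i g"
proof -
  have "nrm j h = nrm i g" if "(j, h) \<in> inj_lim i g" for j h
  proof -
    obtain k where "i \<in> I" "j \<in> I" "k \<in> I" "g \<in> carrier (G i)" "h \<in> carrier (G j)"
        "leI i k" "leI j k" "f i k g = f j k h"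
      using \<open>(j, h) \<in> inj_lim i g\<close> unfolding mem_inj_lim_iff by blast
    then show ?thesis using f_isometric[of i k g] f_isometric[of j k h] by metis
  qed
  then show ?thesis
    unfolding dirlim_norm_def
    using inj_lim_self[OF assms] by (intro the_equality) blast+
qed

text \<open>Isometry forces a trivial kernel: an element with trivial class has norm 0. This
  supplies definiteness of the limit norm.\<close>

lemma inj_lim_eq_one:
  assumes i: "i \<in> I" and g: "g \<in> carrier (G i)" and eq: "inj_lim i g = \<one>\<^bsub>lim\<^esub>"
  shows "g = \<one>\<^bsub>G i\<^esub>"
proof -
  interpret Gi: metric_group "G i" "nrm i" using metric_groups i .
  have "nrm i g = nrm i \<one>\<^bsub>G i\<^esub>"
    using dirlim_norm_inj_lim[OF i g] dirlim_norm_inj_lim[OF i Gi.one_closed] eq lim_one[OF i]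
    by simp
  then show ?thesis using Gi.norm_eq_0_iff[OF g] Gi.norm_one by simp
qed

lemma metric_group_lim: "metric_group lim (dirlim_norm nrm)"
proof (intro metric_group.intro group_lim metric_group_axioms.intro)
  fix A B assume "A \<in> carrier lim" "B \<in> carrier lim"
  then obtain i g h where *: "i \<in> I" "g \<in> carrier (G i)" "h \<in> carrier (G i)"
      "A = inj_lim i g" "B = inj_lim i h"
    by (rule lim_cases2)
  interpret Gi: metric_group "G i" "nrm i" using metric_groups *(1) .
  interpret group_hom "G i" lim "inj_lim i" using group_hom_inj_lim *(1) .
  \<comment> \<open>Here \<open>hom_mult\<close> is removed because it is the equation
    \<open>lim_mult\<close> read in the opposite direction, and the two would loop.\<close>
  show "dirlim_norm nrm (A \<otimes>\<^bsub>lim\<^esub> B) \<le> dirlim_norm nrm A + dirlim_norm nrm B"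
    using *(1-3) Gi.norm_mult unfolding *(4,5) by (simp del: hom_mult add: lim_mult dirlim_norm_inj_lim)
  have "B \<otimes>\<^bsub>lim\<^esub> A \<otimes>\<^bsub>lim\<^esub> inv\<^bsub>lim\<^esub> B = inj_lim i (h \<otimes>\<^bsub>G i\<^esub> g \<otimes>\<^bsub>G i\<^esub> inv\<^bsub>G i\<^esub> h)"
    using *(1-3) unfolding *(4,5) by simp
  moreover have "dirlim_norm nrm (inj_lim i (h \<otimes>\<^bsub>G i\<^esub> g \<otimes>\<^bsub>G i\<^esub> inv\<^bsub>G i\<^esub> h)) = dirlim_norm nrm A"
    using *(1-3) Gi.norm_conj unfolding *(4) by (simp del: hom_mult hom_inv add: dirlim_norm_inj_lim)
  ultimately show "dirlim_norm nrm (B \<otimes>\<^bsub>lim\<^esub> A \<otimes>\<^bsub>lim\<^esub> inv\<^bsub>lim\<^esub> B) = dirlim_norm nrm A"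
    by (simp only:)
next
  fix A assume "A \<in> carrier lim"
  then obtain i g where *: "i \<in> I" "g \<in> carrier (G i)" "A = inj_lim i g" by (rule lim_cases)
  interpret Gi: metric_group "G i" "nrm i" using metric_groups *(1) .
  interpret group_hom "G i" lim "inj_lim i" using group_hom_inj_lim *(1) .
  have "dirlim_norm nrm (inj_lim i (inv\<^bsub>G i\<^esub> g)) = dirlim_norm nrm A"
    using *(1,2) Gi.norm_inv unfolding *(3) by (simp del: hom_inv add: dirlim_norm_inj_lim)
  then show "dirlim_norm nrm (inv\<^bsub>lim\<^esub> A) = dirlim_norm nrm A"
    using *(2) unfolding *(3) by simp
  show "dirlim_norm nrm A = 0 \<longleftrightarrow> A = \<one>\<^bsub>lim\<^esub>"
    using *(1,2) Gi.norm_eq_0_iff inj_lim_eq_one[OF *(1,2)] hom_one unfolding *(3)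
    by (auto simp: dirlim_norm_inj_lim)
qed

section \<open>Metric uniform simplicity of the limit\<close>

lemma metrically_uniformly_simple_lim:
  assumes "\<And>r t :: real. \<lbrakk>0 < r; r < t\<rbrakk> \<Longrightarrow>
           \<exists>N. \<forall>i\<in>I. \<forall>j\<in>I. \<forall>g\<in>carrier (G i). \<forall>h\<in>carrier (G j).
             nrm i g > r \<and> nrm j h < t \<longrightarrow>
             (\<exists>k\<in>I. leI i k \<and> leI j k \<and> f j k h \<in> conj_products N (f i k g) (G k))"
  shows "metrically_uniformly_simple lim (dirlim_norm nrm)"
  unfolding metrically_uniformly_simple_def
proof (intro conjI metric_group_lim allI impI)
  fix r t :: real assume "0 < r \<and> r < t"
  then obtain N where N: "\<forall>i\<in>I. \<forall>j\<in>I. \<forall>g\<in>carrier (G i). \<forall>h\<in>carrier (G j).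
      nrm i g > r \<and> nrm j h < t \<longrightarrow>
      (\<exists>k\<in>I. leI i k \<and> leI j k \<and> f j k h \<in> conj_products N (f i k g) (G k))"
    using assms by meson
  have "B \<in> conj_products N A lim"
    if A: "A \<in> carrier lim" "dirlim_norm nrm A > r" and B: "B \<in> carrier lim" "dirlim_norm nrm B < t"
    for A B
  proof -
    obtain i g where i: "i \<in> I" "g \<in> carrier (G i)" "A = inj_lim i g"
      using A(1) by (rule lim_cases)
    obtain j h where j: "j \<in> I" "h \<in> carrier (G j)" "B = inj_lim j h"
      using B(1) by (rule lim_cases)
    obtain k where k: "k \<in> I" "leI i k" "leI j k" "f j k h \<in> conj_products N (f i k g) (G k)"
      using N i(1,2) j(1,2) A(2) B(2) dirlim_norm_inj_lim[OF i(1,2)] dirlim_norm_inj_lim[OF j(1,2)]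
      unfolding i(3) j(3) by metis
    \<comment> \<open>By \<open>inj_lim_f\<close> the elements \<open>f i k g\<close> and
      \<open>f j k h\<close> still represent \<open>A\<close> and \<open>B\<close>, so the image of
      the membership at stage \<open>k\<close> is the claim, with the same \<open>N\<close>.\<close>
    interpret group_hom "G k" lim "inj_lim k" using group_hom_inj_lim k(1) .
    show ?thesis
      using conj_products_hom[OF _ k(4)] f_closed[of i k g] i j k by (simp add: inj_lim_f)
  qed
  then show "\<exists>N. \<forall>A\<in>carrier lim. dirlim_norm nrm A \<in> {r<..t} \<longrightarrow>
      {B \<in> carrier lim. dirlim_norm nrm B < t} \<subseteq> conj_products N A lim"
    by (intro exI[of _ N]) auto
qed

end

section \<open>Metric ultrapowers\<close>

lemma nonprincipal_ultrafilterD: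
  assumes "nonprincipal_ultrafilter \<U>"
  shows "\<U> \<noteq> bot" "eventually P \<U> \<or> eventually (\<lambda>n. \<not> P n) \<U>"
  using assms by (auto simp: nonprincipal_ultrafilter_def)

text \<open>If \<open>P\<close> does not hold on a large set, its negation does, and there
  \<open>Q\<close> must hold. This settles choices between two alternatives uniformly in the
  index.\<close>

lemma ultrafilter_eventually_disj:
  assumes "nonprincipal_ultrafilter \<U>" "eventually (\<lambda>n. P n \<or> Q n) \<U>"
  shows "eventually P \<U> \<or> eventually Q \<U>"
proof -
  have "eventually Q \<U>" if "eventually (\<lambda>n. \<not> P n) \<U>"
    using assms(2) that by eventually_elim auto
  then show ?thesis using nonprincipal_ultrafilterD(2)[OF assms(1), of P] by blast
qed

text \<open>Compactness gives the image filter a cluster point in \<open>K\<close>. For an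
  ultrafilter a cluster point is a limit: otherwise some open neighbourhood would have a large
  complement.\<close>

lemma ultrafilter_tendsto_compact:
  fixes x :: "'n \<Rightarrow> 'a :: topological_space"
  assumes U: "nonprincipal_ultrafilter \<U>" and K: "compact K" and x: "eventually (\<lambda>n. x n \<in> K) \<U>"
  obtains l where "l \<in> K" "(x \<longlongrightarrow> l) \<U>"
proof -
  have "filtermap x \<U> \<noteq> bot"
    using nonprincipal_ultrafilterD(1)[OF U] by (simp add: filtermap_bot_iff)
  moreover have "eventually (\<lambda>y. y \<in> K) (filtermap x \<U>)"
    using x by (simp add: eventually_filtermap)
  ultimately obtain l where l: "l \<in> K" "inf (nhds l) (filtermap x \<U>) \<noteq> bot"
    using K unfolding compact_filter by blast
  have "eventually (\<lambda>n. x n \<in> S) \<U>" if S: "open S" "l \<in> S" for S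
  proof (rule ccontr)
    assume "\<not> eventually (\<lambda>n. x n \<in> S) \<U>"
    then have "eventually (\<lambda>y. y \<notin> S) (filtermap x \<U>)"
      using nonprincipal_ultrafilterD(2)[OF U] by (auto simp: eventually_filtermap)
    moreover have "eventually (\<lambda>y. y \<in> S) (nhds l)" using S eventually_nhds by blast
    ultimately have "inf (nhds l) (filtermap x \<U>) = bot"
      unfolding trivial_limit_def eventually_inf by blast
    with l show False by simp
  qed
  then have "(x \<longlongrightarrow> l) \<U>" by (rule topological_tendstoI)
  with l that show thesis by blast
qed

text \<open>The bound \<open>B\<close> puts all norms into the compact interval from 0 to
  \<open>B\<close>, so that every norm sequence converges along the ultrafilter to a real
  number.\<close>

locale bounded_ultrapower = metric_group G nrm for G :: "('a, 'b) monoid_scheme" (structure) and nrm +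
  fixes B :: real and \<U> :: "nat filter"
  assumes norm_bounded: "g \<in> carrier G \<Longrightarrow> nrm g \<le> B"
    and ultrafilter: "nonprincipal_ultrafilter \<U>"
begin

abbreviation seqs :: "(nat \<Rightarrow> 'a) monoid" where
  "seqs \<equiv> product_group UNIV (\<lambda>_. G)"

abbreviation null :: "(nat \<Rightarrow> 'a) set" where
  "null \<equiv> ultra_null G nrm \<U>"

abbreviation ult :: "(nat \<Rightarrow> 'a) set monoid" where
  "ult \<equiv> met_ultrapower_fin G nrm \<U>"

definition cls :: "(nat \<Rightarrow> 'a) \<Rightarrow> (nat \<Rightarrow> 'a) set" where
  "cls x = null #>\<^bsub>seqs\<^esub> x"

section \<open>Sequences and the normal subgroup of null sequences\<close>

sublocale seqs: group seqs
  by (rule product_group) (rule group_axioms)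

lemma seqs_memD: "x \<in> carrier seqs \<Longrightarrow> x n \<in> carrier G"
  by (auto simp: PiE_iff)

lemma seqs_memI: "(\<And>n. x n \<in> carrier G) \<Longrightarrow> x \<in> carrier seqs"
  by (auto simp: PiE_iff)

lemma seqs_inv: "x \<in> carrier seqs \<Longrightarrow> inv\<^bsub>seqs\<^esub> x = (\<lambda>n. inv x n)"
  using inv_product_group[of x UNIV "\<lambda>_. G"] group_axioms by (simp add: restrict_def)

lemma norm_tendsto:
  assumes "x \<in> carrier seqs"
  obtains l where "((\<lambda>n. nrm (x n)) \<longlongrightarrow> l) \<U>"
proof -
  have "eventually (\<lambda>n. nrm (x n) \<in> {0..B}) \<U>"
    using seqs_memD[OF assms] norm_nonneg norm_bounded by (intro always_eventually) simp
  then obtain l where "((\<lambda>n. nrm (x n)) \<longlongrightarrow> l) \<U>"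
    by (rule ultrafilter_tendsto_compact[OF ultrafilter compact_Icc])
  then show thesis by (rule that)
qed

lemma null_iff: "x \<in> null \<longleftrightarrow> x \<in> carrier seqs \<and> ((\<lambda>n. nrm (x n)) \<longlongrightarrow> 0) \<U>"
  by (simp add: ultra_null_def)

text \<open>Products are handled by squeezing with the triangle inequality; inversion and
  conjugation leave the norm sequence unchanged term by term.\<close>

lemma null_normal: "null \<lhd> seqs"
proof (rule seqs.normal_invI)
  show "subgroup null seqs"
  proof (rule seqs.subgroupI)
    show "null \<subseteq> carrier seqs" using null_iff by blast
    have "\<one>\<^bsub>seqs\<^esub> \<in> null" using seqs.one_closed by (simp add: null_iff norm_one)
    then show "null \<noteq> {}" by blast
    show "inv\<^bsub>seqs\<^esub> x \<in> null" if "x \<in> null" for x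
    proof -
      have x: "x \<in> carrier seqs" using that by (simp add: null_iff)
      show ?thesis
        using that seqs.inv_closed[OF x] norm_inv[OF seqs_memD[OF x]] seqs_inv[OF x]
        by (simp add: null_iff)
    qed
    show "x \<otimes>\<^bsub>seqs\<^esub> y \<in> null" if "x \<in> null" "y \<in> null" for x y
    proof -
      have xy: "x \<in> carrier seqs" "y \<in> carrier seqs" using that by (auto simp: null_iff)
      have "((\<lambda>n. nrm (x n) + nrm (y n)) \<longlongrightarrow> 0 + 0) \<U>"
        using that by (intro tendsto_add) (auto simp: null_iff)
      then have lim: "((\<lambda>n. nrm (x n) + nrm (y n)) \<longlongrightarrow> 0) \<U>" by simp
      \<comment> \<open>The outer \<open>norm\<close> is the absolute value on the reals, which
        changes nothing since \<open>nrm\<close> is nonnegative on the carrier.\<close>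
      have "norm (nrm (x n \<otimes> y n)) \<le> nrm (x n) + nrm (y n)" for n
        using norm_mult[of "x n" "y n"] norm_nonneg[of "x n \<otimes> y n"] seqs_memD xy by simp
      then have "((\<lambda>n. nrm (x n \<otimes> y n)) \<longlongrightarrow> 0) \<U>"
        by (intro Lim_null_comparison[OF _ lim] always_eventually allI)
      then show ?thesis using seqs.m_closed[OF xy] by (simp add: null_iff)
    qed
  qed
  show "x \<otimes>\<^bsub>seqs\<^esub> e \<otimes>\<^bsub>seqs\<^esub> inv\<^bsub>seqs\<^esub> x \<in> null"
    if x: "x \<in> carrier seqs" and e: "e \<in> null" for x e
  proof -
    have e': "e \<in> carrier seqs" using e by (simp add: null_iff)
    have "x \<otimes>\<^bsub>seqs\<^esub> e \<otimes>\<^bsub>seqs\<^esub> inv\<^bsub>seqs\<^esub> x \<in> carrier seqs"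
      using x e' by (intro seqs.m_closed seqs.inv_closed)
    moreover have "nrm ((x \<otimes>\<^bsub>seqs\<^esub> e \<otimes>\<^bsub>seqs\<^esub> inv\<^bsub>seqs\<^esub> x) n) = nrm (e n)" for n
      using norm_conj[OF seqs_memD[OF e', of n] seqs_memD[OF x, of n]] by (simp add: seqs_inv[OF x])
    ultimately show ?thesis using e by (simp only: null_iff)
  qed
qed

lemmas null_subgroup = normal_imp_subgroup[OF null_normal]

section \<open>Limit norms of cosets\<close>

lemma ultra_norm_cls:
  assumes x: "x \<in> carrier seqs" and l: "((\<lambda>n. nrm (x n)) \<longlongrightarrow> l) \<U>"
  shows "ultra_norm nrm \<U> (cls x) = ereal l"
proof -
  \<comment> \<open>Independence of the representative: \<open>y\<close> is a null sequence
    \<open>e\<close> times \<open>x\<close>, so by \<open>norm_mult_diff\<close> the two norm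
    sequences differ by at most \<open>nrm (e n)\<close>, which tends to 0.\<close>
  have lim: "Lim \<U> (\<lambda>n. ereal (nrm (y n))) = ereal l" if y: "y \<in> cls x" for y
  proof -
    obtain e where e: "e \<in> null" and ye: "y = e \<otimes>\<^bsub>seqs\<^esub> x"
      using y unfolding cls_def r_coset_def by blast
    have e': "e \<in> carrier seqs" and e0: "((\<lambda>n. nrm (e n)) \<longlongrightarrow> 0) \<U>" using e by (auto simp: null_iff)
    have "((\<lambda>n. nrm (y n) - nrm (x n)) \<longlongrightarrow> 0) \<U>"
      using norm_mult_diff[OF seqs_memD[OF e'] seqs_memD[OF x]]
      by (intro Lim_null_comparison[OF _ e0] always_eventually) (simp add: ye)
    from tendsto_add[OF this l] have "((\<lambda>n. nrm (y n)) \<longlongrightarrow> l) \<U>" by simp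
    then have "((\<lambda>n. ereal (nrm (y n))) \<longlongrightarrow> ereal l) \<U>" by (rule tendsto_ereal)
    then show ?thesis by (intro tendsto_Lim nonprincipal_ultrafilterD(1)[OF ultrafilter])
  qed
  have "x \<in> cls x"
    unfolding cls_def by (rule seqs.rcos_self[OF x null_subgroup])
  with lim show ?thesis
    unfolding ultra_norm_def by (intro the_equality) (auto; metis)+
qed

lemma ultra_fin_norm_cls:
  assumes "x \<in> carrier seqs" "((\<lambda>n. nrm (x n)) \<longlongrightarrow> l) \<U>"
  shows "ultra_fin_norm nrm \<U> (cls x) = l"
  using ultra_norm_cls[OF assms] by (simp add: ultra_fin_norm_def)

lemma norm_tendsto_ultra_fin_norm:
  assumes "x \<in> carrier seqs"
  shows "((\<lambda>n. nrm (x n)) \<longlongrightarrow> ultra_fin_norm nrm \<U> (cls x)) \<U>"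
  using norm_tendsto[OF assms] ultra_fin_norm_cls[OF assms] by metis

section \<open>The ultrapower as a metric group\<close>

lemma carrier_ultrapower: "carrier (met_ultrapower G nrm \<U>) = cls ` carrier seqs"
  unfolding met_ultrapower_def carrier_FactGroup cls_def ..

text \<open>All norm limits are real, so restricting to finite norm discards nothing and the theory
  of quotient groups applies to \<open>ult\<close>.\<close>

lemma ult_eq: "ult = met_ultrapower G nrm \<U>"
proof -
  have "ultra_norm nrm \<U> (cls x) < \<infinity>" if x: "x \<in> carrier seqs" for x
    using norm_tendsto[OF x] ultra_norm_cls[OF x] by (metis less_ereal.simps(4) ereal_less_PInfty)
  then have "{A \<in> carrier (met_ultrapower G nrm \<U>). ultra_norm nrm \<U> A < \<infinity>} =
      carrier (met_ultrapower G nrm \<U>)"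
    by (auto simp: carrier_ultrapower)
  then show ?thesis by (simp add: met_ultrapower_fin_def)
qed

lemma carrier_ult: "carrier ult = cls ` carrier seqs"
  by (simp only: ult_eq carrier_ultrapower)

sublocale cls: group_hom seqs ult cls
  using normal.factorgroup_is_group[OF null_normal] normal.r_coset_hom_Mod[OF null_normal] seqs.group_axioms
  unfolding ult_eq met_ultrapower_def cls_def[abs_def]
  by (intro group_hom.intro group_hom_axioms.intro)

lemma cls_eq_one_iff: "x \<in> carrier seqs \<Longrightarrow> cls x = \<one>\<^bsub>ult\<^esub> \<longleftrightarrow> x \<in> null"
  using seqs.coset_join2[OF _ null_subgroup] seqs.rcos_self[OF _ null_subgroup]
  by (auto simp: ult_eq met_ultrapower_def cls_def)

text \<open>The norm laws hold term by term and pass to the limit. Definiteness holds because the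
  sequences of limit norm 0 are exactly those factored out.\<close>

lemma metric_group_ult: "metric_group ult (ultra_fin_norm nrm \<U>)"
proof (intro metric_group.intro cls.H.group_axioms metric_group_axioms.intro)
  note bot = nonprincipal_ultrafilterD(1)[OF ultrafilter]
  fix X Y assume "X \<in> carrier ult" "Y \<in> carrier ult"
  then obtain x y where x: "x \<in> carrier seqs" "X = cls x" and y: "y \<in> carrier seqs" "Y = cls y"
    unfolding carrier_ult by blast
  note xn = norm_tendsto_ultra_fin_norm[OF x(1)] and yn = norm_tendsto_ultra_fin_norm[OF y(1)]
  have "((\<lambda>n. nrm (x n \<otimes> y n)) \<longlongrightarrow> ultra_fin_norm nrm \<U> (cls (x \<otimes>\<^bsub>seqs\<^esub> y))) \<U>"
    using norm_tendsto_ultra_fin_norm[OF seqs.m_closed[OF x(1) y(1)]] by simp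
  then have "ultra_fin_norm nrm \<U> (cls (x \<otimes>\<^bsub>seqs\<^esub> y)) \<le>
      ultra_fin_norm nrm \<U> (cls x) + ultra_fin_norm nrm \<U> (cls y)"
    using norm_mult[OF seqs_memD[OF x(1)] seqs_memD[OF y(1)]]
    by (intro tendsto_le[OF bot tendsto_add[OF xn yn]] always_eventually) auto
  then show "ultra_fin_norm nrm \<U> (X \<otimes>\<^bsub>ult\<^esub> Y) \<le> ultra_fin_norm nrm \<U> X + ultra_fin_norm nrm \<U> Y"
    using cls.hom_mult[OF x(1) y(1)] x y by simp
  have "Y \<otimes>\<^bsub>ult\<^esub> X \<otimes>\<^bsub>ult\<^esub> inv\<^bsub>ult\<^esub> Y = cls (y \<otimes>\<^bsub>seqs\<^esub> x \<otimes>\<^bsub>seqs\<^esub> inv\<^bsub>seqs\<^esub> y)"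
    using x y by (simp only: cls.hom_mult cls.hom_inv seqs.m_closed seqs.inv_closed)
  moreover have "ultra_fin_norm nrm \<U> (cls (y \<otimes>\<^bsub>seqs\<^esub> x \<otimes>\<^bsub>seqs\<^esub> inv\<^bsub>seqs\<^esub> y)) = ultra_fin_norm nrm \<U> (cls x)"
  proof (rule ultra_fin_norm_cls)
    show "y \<otimes>\<^bsub>seqs\<^esub> x \<otimes>\<^bsub>seqs\<^esub> inv\<^bsub>seqs\<^esub> y \<in> carrier seqs"
      using x y by (intro seqs.m_closed seqs.inv_closed)
    show "((\<lambda>n. nrm ((y \<otimes>\<^bsub>seqs\<^esub> x \<otimes>\<^bsub>seqs\<^esub> inv\<^bsub>seqs\<^esub> y) n)) \<longlongrightarrow> ultra_fin_norm nrm \<U> (cls x)) \<U>"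
      using xn norm_conj[OF seqs_memD[OF x(1)] seqs_memD[OF y(1)]] by (simp add: seqs_inv[OF y(1)])
  qed
  ultimately show "ultra_fin_norm nrm \<U> (Y \<otimes>\<^bsub>ult\<^esub> X \<otimes>\<^bsub>ult\<^esub> inv\<^bsub>ult\<^esub> Y) = ultra_fin_norm nrm \<U> X"
    using x by simp
next
  fix X assume "X \<in> carrier ult"
  then obtain x where x: "x \<in> carrier seqs" "X = cls x"
    unfolding carrier_ult by blast
  note xn = norm_tendsto_ultra_fin_norm[OF x(1)]
  have "ultra_fin_norm nrm \<U> (cls (inv\<^bsub>seqs\<^esub> x)) = ultra_fin_norm nrm \<U> (cls x)"
  proof (rule ultra_fin_norm_cls[OF seqs.inv_closed[OF x(1)]])
    show "((\<lambda>n. nrm ((inv\<^bsub>seqs\<^esub> x) n)) \<longlongrightarrow> ultra_fin_norm nrm \<U> (cls x)) \<U>"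
      using xn norm_inv[OF seqs_memD[OF x(1)]] by (simp add: seqs_inv[OF x(1)])
  qed
  then show "ultra_fin_norm nrm \<U> (inv\<^bsub>ult\<^esub> X) = ultra_fin_norm nrm \<U> X"
    using x by (simp only: cls.hom_inv)
  have "ultra_fin_norm nrm \<U> (cls x) = 0 \<longleftrightarrow> x \<in> null"
    using x(1) xn ultra_fin_norm_cls[OF x(1), of 0] unfolding null_iff by metis
  then show "ultra_fin_norm nrm \<U> X = 0 \<longleftrightarrow> X = \<one>\<^bsub>ult\<^esub>"
    using cls_eq_one_iff[OF x(1)] x(2) by simp
qed

section \<open>From properties on large index sets to properties of cosets\<close>

lemma cls_cong:
  assumes x: "x \<in> carrier seqs" and y: "y \<in> carrier seqs" and eq: "eventually (\<lambda>n. x n = y n) \<U>"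
  shows "cls x = cls y"
proof -
  \<comment> \<open>Where the sequences agree their quotient is the unit, so its norms are
    eventually 0 and the quotient is a null sequence.\<close>
  have "eventually (\<lambda>n. nrm (x n \<otimes> inv y n) = 0) \<U>"
    using eq by eventually_elim (use seqs_memD[OF y] norm_one in auto)
  then have "((\<lambda>n. nrm (x n \<otimes> inv y n)) \<longlongrightarrow> 0) \<U>" by (rule tendsto_eventually)
  then have "x \<otimes>\<^bsub>seqs\<^esub> inv\<^bsub>seqs\<^esub> y \<in> null"
    using seqs.m_closed[OF x seqs.inv_closed[OF y]] by (simp add: null_iff seqs_inv[OF y])
  then have "x \<in> cls y"
    unfolding cls_def by (rule subgroup.rcos_module_rev[OF null_subgroup seqs.group_axioms y x])
  then show ?thesis
    unfolding cls_def by (rule seqs.repr_independence[OF _ y null_subgroup, symmetric])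
qed

lemma cls_eventually_one:
  assumes "x \<in> carrier seqs" "eventually (\<lambda>n. x n = \<one>) \<U>"
  shows "cls x = \<one>\<^bsub>ult\<^esub>"
  using cls_cong[OF assms(1) seqs.one_closed] assms(2) cls.hom_one by simp

text \<open>The existential step of an argument in the style of Los's theorem: termwise witnesses
  are collected into one sequence.\<close>

lemma seqs_choice:
  assumes "eventually (\<lambda>n. \<exists>z\<in>carrier G. P n z) \<U>"
  obtains z where "z \<in> carrier seqs" "eventually (\<lambda>n. P n (z n)) \<U>"
proof -
  \<comment> \<open>At indices without a witness an arbitrary element of the carrier stands in, so
    that the sequence lies in the carrier everywhere.\<close>
  have "\<forall>n. \<exists>z. z \<in> carrier G \<and> ((\<exists>z\<in>carrier G. P n z) \<longrightarrow> P n z)" by blast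
  then obtain z where z: "\<And>n. z n \<in> carrier G" "\<And>n. (\<exists>z\<in>carrier G. P n z) \<longrightarrow> P n (z n)"
    by metis
  have "eventually (\<lambda>n. P n (z n)) \<U>"
    using assms by eventually_elim (use z in blast)
  then show thesis using that seqs_memI[of z] z(1) by blast
qed

text \<open>Instead of splitting \<open>\<U>\<close>-almost all indices by number and signs of the factors, the
  factors are split off one at a time; each step needs only a binary choice by the ultrafilter.\<close>

lemma cls_conj_products:
  assumes x: "x \<in> carrier seqs" and "y \<in> carrier seqs"
    and "eventually (\<lambda>n. y n \<in> conj_products N (x n) G) \<U>"
  shows "cls y \<in> conj_products N (cls x) ult"
  using assms(2,3)
proof (induction N arbitrary: y)
  case 0
  then show ?case using cls_eventually_one by (simp add: conj_products_0)
next
  case (Suc N)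
  note y = Suc.prems(1)
  \<comment> \<open>All three quantifiers are bounded by the carrier so that
    \<open>seqs_choice\<close> can extract the conjugator \<open>c\<close>, the signed element
    \<open>s\<close> and the remaining product \<open>p\<close> in turn.\<close>
  have "eventually (\<lambda>n. y n = \<one> \<or> (\<exists>c\<in>carrier G. \<exists>s\<in>carrier G. \<exists>p\<in>carrier G.
      (s = x n \<or> s = inv x n) \<and> p \<in> conj_products N (x n) G \<and> y n = (c \<otimes> s \<otimes> inv c) \<otimes> p)) \<U>"
    using Suc.prems(2)
  proof eventually_elim
    case (elim n)
    have xn: "x n \<in> carrier G" using seqs_memD[OF x] .
    from elim show ?case
    proof (cases rule: conj_products_SucE)
      case 1
      then show ?thesis by simp
    next
      case (2 c s p)
      then have "s \<in> carrier G" "p \<in> carrier G" "s = x n \<or> s = inv x n"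
        using xn conj_products_closed[OF xn] by auto
      with 2 show ?thesis by blast
    qed
  qed
  from ultrafilter_eventually_disj[OF ultrafilter this]
  consider "eventually (\<lambda>n. y n = \<one>) \<U>"
    | "eventually (\<lambda>n. \<exists>c\<in>carrier G. \<exists>s\<in>carrier G. \<exists>p\<in>carrier G.
      (s = x n \<or> s = inv x n) \<and> p \<in> conj_products N (x n) G \<and> y n = (c \<otimes> s \<otimes> inv c) \<otimes> p) \<U>"
    by (elim disjE)
  then show ?case
  proof cases
    case 1
    then show ?thesis using cls_eventually_one[OF y] one_in_conj_products[of ult] by simp
  next
    case 2
    then obtain c where c: "c \<in> carrier seqs" "eventually (\<lambda>n. \<exists>s\<in>carrier G. \<exists>p\<in>carrier G.
        (s = x n \<or> s = inv x n) \<and> p \<in> conj_products N (x n) G \<and> y n = (c n \<otimes> s \<otimes> inv c n) \<otimes> p) \<U>"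
      by (rule seqs_choice)
    from c(2) obtain s where s: "s \<in> carrier seqs" "eventually (\<lambda>n. \<exists>p\<in>carrier G.
        (s n = x n \<or> s n = inv x n) \<and> p \<in> conj_products N (x n) G \<and> y n = (c n \<otimes> s n \<otimes> inv c n) \<otimes> p) \<U>"
      by (rule seqs_choice)
    from s(2) obtain p where p: "p \<in> carrier seqs" and csp: "eventually (\<lambda>n.
        (s n = x n \<or> s n = inv x n) \<and> p n \<in> conj_products N (x n) G \<and> y n = (c n \<otimes> s n \<otimes> inv c n) \<otimes> p n) \<U>"
      by (rule seqs_choice)
    have sx: "eventually (\<lambda>n. s n = x n \<or> s n = inv x n) \<U>"
      and pn: "eventually (\<lambda>n. p n \<in> conj_products N (x n) G) \<U>"
      and yn: "eventually (\<lambda>n. y n = (c n \<otimes> s n \<otimes> inv c n) \<otimes> p n) \<U>"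
      using csp by (auto elim: eventually_mono)
    \<comment> \<open>The sign of the factor may vary with the index, but the ultrafilter selects
      one sign that occurs on a large set.\<close>
    have "cls s = cls x \<or> cls s = cls (inv\<^bsub>seqs\<^esub> x)"
      using ultrafilter_eventually_disj[OF ultrafilter sx] cls_cong[OF s(1) x]
        cls_cong[OF s(1) seqs.inv_closed[OF x]] by (auto simp only: seqs_inv[OF x])
    then have s': "cls s \<in> {cls x, inv\<^bsub>ult\<^esub> cls x}" using cls.hom_inv[OF x] by simp
    have "cls y = cls ((c \<otimes>\<^bsub>seqs\<^esub> s \<otimes>\<^bsub>seqs\<^esub> inv\<^bsub>seqs\<^esub> c) \<otimes>\<^bsub>seqs\<^esub> p)"
      using yn c s p seqs_inv[OF c(1)]
      by (intro cls_cong y seqs.m_closed seqs.inv_closed) simp_all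
    also have "\<dots> = (cls c \<otimes>\<^bsub>ult\<^esub> cls s \<otimes>\<^bsub>ult\<^esub> inv\<^bsub>ult\<^esub> cls c) \<otimes>\<^bsub>ult\<^esub> cls p"
      using c s p by (simp only: cls.hom_mult cls.hom_inv seqs.m_closed seqs.inv_closed)
    finally show ?thesis
      using conj_products_SucI[OF cls.hom_closed[OF c(1)] s' Suc.IH[OF p pn]] by simp
  qed
qed

section \<open>Metric uniform simplicity of the ultrapower\<close>

lemma metrically_uniformly_simple_ult:
  assumes "metrically_uniformly_simple G nrm"
  shows "metrically_uniformly_simple ult (ultra_fin_norm nrm \<U>)"
  unfolding metrically_uniformly_simple_def
proof (intro conjI metric_group_ult allI impI)
  fix r t :: real assume rt: "0 < r \<and> r < t"
  \<comment> \<open>A limit equal to \<open>t\<close> allows terms slightly above \<open>t\<close>,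
    so the upper end is enlarged by 1. At the lower end the strict inequality for the limit already
    holds on a large set.\<close>
  then have "0 < r \<and> r < t + 1" by simp
  then obtain N where N: "\<And>g h. \<lbrakk>g \<in> carrier G; h \<in> carrier G; r < nrm g; nrm g \<le> t + 1; nrm h < t + 1\<rbrakk>
      \<Longrightarrow> h \<in> conj_products N g G"
    using assms unfolding metrically_uniformly_simple_def
    by (smt (verit, best) greaterThanAtMost_iff mem_Collect_eq subsetD)
  have "Y \<in> conj_products N X ult"
    if XY: "X \<in> carrier ult" "ultra_fin_norm nrm \<U> X \<in> {r<..t}" "Y \<in> carrier ult" "ultra_fin_norm nrm \<U> Y < t"
    for X Y
  proof -
    obtain x y where x: "x \<in> carrier seqs" "X = cls x" and y: "y \<in> carrier seqs" "Y = cls y"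
      using XY(1,3) unfolding carrier_ult by blast
    note xn = norm_tendsto_ultra_fin_norm[OF x(1)] and yn = norm_tendsto_ultra_fin_norm[OF y(1)]
    have "eventually (\<lambda>n. r < nrm (x n)) \<U>" "eventually (\<lambda>n. nrm (x n) < t + 1) \<U>"
        "eventually (\<lambda>n. nrm (y n) < t + 1) \<U>"
      using order_tendstoD[OF xn] order_tendstoD[OF yn] XY x(2) y(2) by auto
    then have "eventually (\<lambda>n. y n \<in> conj_products N (x n) G) \<U>"
      by eventually_elim (use N seqs_memD[OF x(1)] seqs_memD[OF y(1)] in simp)
    then show ?thesis using cls_conj_products[OF x(1) y(1)] x(2) y(2) by simp
  qed
  then show "\<exists>N. \<forall>X\<in>carrier ult. ultra_fin_norm nrm \<U> X \<in> {r<..t} \<longrightarrow>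
      {Y \<in> carrier ult. ultra_fin_norm nrm \<U> Y < t} \<subseteq> conj_products N X ult"
    by (intro exI[of _ N]) auto
qed

end

theorem theorem10p1:
  fixes I :: "'i set" and leI :: "'i \<Rightarrow> 'i \<Rightarrow> bool"
    and G :: "'i \<Rightarrow> ('a, 'b) monoid_scheme"
    and nrm :: "'i \<Rightarrow> 'a \<Rightarrow> real"
    and f :: "'i \<Rightarrow> 'i \<Rightarrow> 'a \<Rightarrow> 'a"
  assumes "direct_system I leI G nrm f"
    and "\<And>i g. \<lbrakk>i \<in> I; g \<in> carrier (G i)\<rbrakk> \<Longrightarrow> nrm i g \<le> 1"
    and "\<And>r t :: real. \<lbrakk>0 < r; r < t\<rbrakk> \<Longrightarrow>
           \<exists>N. \<forall>i\<in>I. \<forall>j\<in>I. \<forall>g\<in>carrier (G i). \<forall>h\<in>carrier (G j).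
             nrm i g > r \<and> nrm j h < t \<longrightarrow>
             (\<exists>k\<in>I. leI i k \<and> k \<noteq> i \<and> leI j k \<and> k \<noteq> j \<and>
                f j k h \<in> conj_products N (f i k g) (G k))"
  shows "metrically_uniformly_simple (dirlim I leI G f) (dirlim_norm nrm) \<and>
         (\<forall>\<U> :: nat filter. nonprincipal_ultrafilter \<U> \<longrightarrow>
            metrically_uniformly_simple
              (met_ultrapower_fin (dirlim I leI G f) (dirlim_norm nrm) \<U>)
              (ultra_fin_norm (dirlim_norm nrm) \<U>))"
proof (intro conjI allI impI)
  interpret direct_system I leI G nrm f by (rule assms(1))
  have "\<exists>N. \<forall>i\<in>I. \<forall>j\<in>I. \<forall>g\<in>carrier (G i). \<forall>h\<in>carrier (G j).
      nrm i g > r \<and> nrm j h < t \<longrightarrow>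
      (\<exists>k\<in>I. leI i k \<and> leI j k \<and> f j k h \<in> conj_products N (f i k g) (G k))"
    if "0 < r" "r < t" for r t
    using assms(3)[OF that] by meson
  then show simple: "metrically_uniformly_simple (dirlim I leI G f) (dirlim_norm nrm)"
    by (rule metrically_uniformly_simple_lim)
  fix \<U> :: "nat filter" assume "nonprincipal_ultrafilter \<U>"
  \<comment> \<open>The common bound on the stages passes to the limit through representatives and
    serves as the constant \<open>B\<close> of the locale.\<close>
  moreover have "dirlim_norm nrm A \<le> 1" if "A \<in> carrier lim" for A
    using lim_cases[OF that] assms(2) dirlim_norm_inj_lim by metis
  ultimately have "bounded_ultrapower lim (dirlim_norm nrm) 1 \<U>"
    by (intro bounded_ultrapower.intro bounded_ultrapower_axioms.intro metric_group_lim)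
  from this simple show "metrically_uniformly_simple (met_ultrapower_fin lim (dirlim_norm nrm) \<U>)
      (ultra_fin_norm (dirlim_norm nrm) \<U>)"
    by (rule bounded_ultrapower.metrically_uniformly_simple_ult)
qed

end
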